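(* Let $k \ge 3$ and let $B$ be a non-empty finite word over $\mathbb{N}$ that is a factor of $\mathbf{W}^{(k)}$. (a) The shifted word $k \oplus B$ is again a factor of $\mathbf{W}^{(k)}$. (b) Suppose in addition that for every $n \ge k$, every occurrence of $k \oplus B$ in $W_n^{(k)}$ is included, i.e. lies entirely inside one of the $k$ blocks $W_{n-1}^{(k)}, W_{n-2}^{(k)}, \dots, W_{n-k+1}^{(k)}, k \oplus W_{n-k}^{(k)}$ of the decomposition $W_n^{(k)} = W_{n-1}^{(k)} W_{n-2}^{(k)} \cdots W_{n-k+1}^{(k)} (k \oplus W_{n-k}^{(k)})$ (equivalently, no occurrence of $k\oplus B$ overlaps two consecutive blocks). Then, as formal power series, \[ C_{k \oplus B}^{(k)}(y) = y^k\, H_{k-1}(y)\, C_B^{(k)}(y). \]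
   Context: Words are over the alphabet $\mathbb{N}=\{0,1,2,\dots\}$ (letters called digits). For $k\ge 2$, $\phi_k:\mathbb{N}^*\to\mathbb{N}^*$ is the morphism defined for $i\in\mathbb{N}$, $0\le j\le k-1$ by $\phi_k(ki+j)=(ki)(ki+j+1)$ if $0\le j\le k-2$ and $\phi_k(ki+k-1)=ki+k$ (juxtaposition is concatenation). Set $W_n^{(k)}=\phi_k^n(0)$ and $\mathbf{W}^{(k)}=\lim_n \phi_k^n(0)$, the infinite fixed point; each $W_n^{(k)}$ is a prefix of $\mathbf{W}^{(k)}$. It is known that for $n\ge k$, $W_n^{(k)} = W_{n-1}^{(k)} W_{n-2}^{(k)} \cdots W_{n-k+1}^{(k)} (k \oplus W_{n-k}^{(k)})$. For $n\in\mathbb{N}$ and a word $W=w_0\cdots w_{m-1}$, the shift is $n\oplus W=(w_0+n)\cdots(w_{m-1}+n)$. For a nonempty word $B$, $|W|_B$ is the number of (possibly overlapping) occurrences of $B$ as a factor of $W$; $c^{(k)}(B;n)=|W_n^{(k)}|_B$ and $C_B^{(k)}(y)=\sum_{n\ge0} c^{(k)}(B;n)y^n$. For $m\ge 2$, $H_m(y)=1/(1-y-y^2-\cdots-y^m)$ as a formal power series. *)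

theory Defs
  imports "HOL-Computational_Algebra.Formal_Power_Series" "HOL-Library.Sublist"
begin

text \<open>Finite words over the natural numbers are lists, infinite words are functions on \<^typ>\<open>nat\<close>.\<close>

definition phi_letter :: "nat \<Rightarrow> nat \<Rightarrow> nat list" where
  "phi_letter k a =
     (let i = a div k; j = a mod k
      in if j + 2 \<le> k then [k * i, k * i + j + 1] else [k * i + k])"

definition phi :: "nat \<Rightarrow> nat list \<Rightarrow> nat list" where
  "phi k w = concat (map (phi_letter k) w)"

definition W :: "nat \<Rightarrow> nat \<Rightarrow> nat list" where
  "W k n = (phi k ^^ n) [0]"

text \<open>The letterwise limit of the words \<^term>\<open>W k n\<close>; for \<open>k \<ge> 2\<close> it exists by
  \<open>W_inf_nth\<close> and \<open>length_W\<close> below.\<close>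

definition W_inf :: "nat \<Rightarrow> nat \<Rightarrow> nat" where
  "W_inf k i = (THE a. \<forall>\<^sub>F n in sequentially. i < length (W k n) \<and> W k n ! i = a)"

definition factor_inf :: "nat list \<Rightarrow> (nat \<Rightarrow> nat) \<Rightarrow> bool" where
  "factor_inf B w \<longleftrightarrow> (\<exists>p. map w [p..<p + length B] = B)"

definition shift :: "nat \<Rightarrow> nat list \<Rightarrow> nat list" (infixr "\<oplus>" 75) where
  "n \<oplus> w = map (\<lambda>a. a + n) w"

definition occurrences :: "nat list \<Rightarrow> nat list \<Rightarrow> nat set" where
  "occurrences B w = {p. p + length B \<le> length w \<and> take (length B) (drop p w) = B}"

definition count_factor :: "nat list \<Rightarrow> nat list \<Rightarrow> nat" where
  "count_factor w B = card (occurrences B w)"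

text \<open>The blocks of the decomposition of \<^term>\<open>W k n\<close>, meaningful for \<open>n \<ge> k\<close>.\<close>

definition blocks :: "nat \<Rightarrow> nat \<Rightarrow> nat list list" where
  "blocks k n = map (\<lambda>j. W k (n - j)) [1..<k] @ [k \<oplus> W k (n - k)]"

text \<open>In the concatenation of \<open>bs\<close>, the positions \<open>p, \<dots>, p + l - 1\<close> all belong to one block.\<close>

definition within_block :: "nat list list \<Rightarrow> nat \<Rightarrow> nat \<Rightarrow> bool" where
  "within_block bs p l \<longleftrightarrow>
     (\<exists>us b vs. bs = us @ b # vs \<and> length (concat us) \<le> p
        \<and> p + l \<le> length (concat us) + length b)"

definition all_occurrences_included :: "nat \<Rightarrow> nat list \<Rightarrow> bool" where
  "all_occurrences_included k B \<longleftrightarrow>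
     (\<forall>n\<ge>k. \<forall>p\<in>occurrences B (W k n). within_block (blocks k n) p (length B))"

definition C_fps :: "nat \<Rightarrow> nat list \<Rightarrow> rat fps" where
  "C_fps k B = Abs_fps (\<lambda>n. of_nat (count_factor (W k n) B))"

definition H_fps :: "nat \<Rightarrow> rat fps" where
  "H_fps m = 1 / (1 - (\<Sum>i=1..m. fps_X ^ i))"

lemma W_Suc: "W k (Suc n) = phi k (W k n)"
  by (simp add: W_def)

lemma W_prefix_Suc:
  assumes "k \<ge> 2"
  shows "prefix (W k n) (W k (Suc n))"
proof (induction n)
  case 0
  show ?case using assms by (simp add: W_def phi_def phi_letter_def)
next
  case (Suc n)
  then obtain v where "W k (Suc n) = W k n @ v" by (auto simp: prefix_def)
  then have "W k (Suc (Suc n)) = W k (Suc n) @ phi k v"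
    unfolding W_Suc[of k "Suc n"] by (simp add: phi_def W_Suc)
  then show ?case by simp
qed

lemma W_prefix:
  assumes "k \<ge> 2" and "m \<le> n"
  shows "prefix (W k m) (W k n)"
  using assms(2)
  by (induction rule: dec_induct) (auto intro: prefix_order.trans W_prefix_Suc[OF assms(1)])

lemma length_phi: "length w \<le> length (phi k w)"
  by (induction w) (auto simp: phi_def phi_letter_def Let_def)

lemma length_W:
  assumes "k \<ge> 2"
  shows "n < length (W k n)"
proof (induction n)
  case 0
  show ?case by (simp add: W_def)
next
  case (Suc n)
  have "prefix [0] (W k n)" using W_prefix[OF assms, of 0 n] by (simp add: W_def)
  then obtain v where v: "W k n = 0 # v" by (auto simp: prefix_def)
  have "phi k (0 # v) = [0, 1] @ phi k v"
    using assms by (simp add: phi_def phi_letter_def)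
  then have "length (W k (Suc n)) \<ge> Suc (length (W k n))"
    using length_phi[of v k] by (simp add: W_Suc v)
  with Suc show ?case by simp
qed

lemma W_inf_nth:
  assumes "k \<ge> 2" and "i < length (W k n)"
  shows "W_inf k i = W k n ! i"
  unfolding W_inf_def
proof (rule the_equality)
  have *: "i < length (W k m) \<and> W k m ! i = W k n ! i" if "m \<ge> n" for m
    using W_prefix[OF assms(1) that] assms(2) by (auto simp: prefix_def nth_append)
  then show "\<forall>\<^sub>F m in sequentially. i < length (W k m) \<and> W k m ! i = W k n ! i"
    unfolding eventually_sequentially by blast
  fix a assume "\<forall>\<^sub>F m in sequentially. i < length (W k m) \<and> W k m ! i = a"
  then obtain N where "\<forall>m\<ge>N. W k m ! i = a" by (auto simp: eventually_sequentially)
  then have "W k (max n N) ! i = a" by simp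
  moreover have "W k (max n N) ! i = W k n ! i" using *[of "max n N"] by simp
  ultimately show "a = W k n ! i" by (rule trans[OF sym])
qed

end

theory Submission
  imports Defs
begin

text \<open>Unfolding \<open>\<phi>\<^sub>k(j) = 0 (j + 1)\<close> repeatedly in \<open>\<phi>\<^sub>k\<^sup>n(0)\<close> and using that \<open>\<phi>\<^sub>k\<close> commutes with the
  shift by \<open>k\<close> yields the block decomposition of \<^term>\<open>W k n\<close>. Its last block is a shifted copy of
  \<^term>\<open>W k (n - k)\<close>, which gives (a). If no occurrence of \<^term>\<open>k \<oplus> B\<close> straddles two blocks, its
  counts satisfy a linear recurrence with inhomogeneous term the count of \<open>B\<close> in
  \<^term>\<open>W k (n - k)\<close>; the initial counts vanish because the letters of \<^term>\<open>W k n\<close> are at most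
  \<open>n\<close>. Multiplying by the denominator of \<^term>\<open>H_fps (k - 1)\<close> is this recurrence.\<close>

section \<open>Block decomposition and letter bound\<close>

lemma phi_append: "phi k (u @ v) = phi k u @ phi k v"
  by (simp add: phi_def)

lemma funpow_phi_append: "(phi k ^^ n) (u @ v) = (phi k ^^ n) u @ (phi k ^^ n) v"
  by (induction n) (simp_all add: phi_append)

lemma shift_append: "m \<oplus> (u @ v) = (m \<oplus> u) @ (m \<oplus> v)"
  by (simp add: shift_def)

lemma length_shift [simp]: "length (m \<oplus> w) = length w"
  by (simp add: shift_def)

text \<open>Adding \<open>k\<close> raises the quotient by one and keeps the remainder, so the same
  case of the definition applies.\<close>

lemma phi_letter_add:
  assumes "k > 0"
  shows "phi_letter k (a + k) = k \<oplus> phi_letter k a"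
  using assms by (simp add: phi_letter_def shift_def Let_def)

lemma phi_shift:
  assumes "k > 0"
  shows "phi k (k \<oplus> w) = k \<oplus> phi k w"
  by (induction w) (simp_all add: phi_def shift_def phi_letter_add[OF assms])

lemma funpow_phi_shift:
  assumes "k > 0"
  shows "(phi k ^^ n) (k \<oplus> w) = k \<oplus> (phi k ^^ n) w"
  by (induction n) (simp_all add: phi_shift[OF assms])

text \<open>Each induction step expands the remaining letter \<open>j\<close> once: the new 0 yields
  the block \<open>W k (n - Suc j)\<close>, and the letter \<open>Suc j\<close> is left
  over.\<close>

lemma W_unfold:
  assumes "j < k" and "j \<le> n"
  shows "W k n = concat (map (\<lambda>i. W k (n - i)) [1..<Suc j]) @ (phi k ^^ (n - j)) [j]"
  using assms
proof (induction j)
  case 0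
  then show ?case by (simp add: W_def)
next
  case (Suc j)
  have n: "n - j = Suc (n - Suc j)" using Suc.prems by simp
  have "phi k [j] = [0] @ [Suc j]"
    using Suc.prems by (simp add: phi_def phi_letter_def)
  then have "(phi k ^^ (n - j)) [j] = W k (n - Suc j) @ (phi k ^^ (n - Suc j)) [Suc j]"
    by (simp only: n funpow_Suc_right o_apply funpow_phi_append W_def)
  with Suc show ?case by simp
qed

text \<open>The unfolding stops at the letter \<open>k - 1\<close>, whose image is the single letter
  \<open>k\<close>, that is, 0 shifted by \<open>k\<close>; the shift then moves outside the powers
  of \<open>phi k\<close>.\<close>

lemma W_eq_concat_blocks:
  assumes "k > 0" and "k \<le> n"
  shows "W k n = concat (blocks k n)"
proof -
  have n: "n - (k - 1) = Suc (n - k)" using assms by simp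
  have "phi k [k - 1] = k \<oplus> [0]"
    using assms by (auto simp: phi_def phi_letter_def shift_def Let_def)
  then have "(phi k ^^ (n - (k - 1))) [k - 1] = k \<oplus> W k (n - k)"
    by (simp only: n funpow_Suc_right o_apply funpow_phi_shift[OF assms(1)] W_def)
  with W_unfold[of "k - 1" k n] assms show ?thesis
    by (simp add: blocks_def)
qed

lemma phi_letter_le:
  assumes "x \<in> set (phi_letter k a)"
  shows "x \<le> Suc a"
proof -
  \<comment> \<open>The guard of the third case is kept: it gives
    \<open>k \<le> a mod k + 1\<close>, which bounds \<open>k * (a div k) + k\<close> by
    \<open>a + 1\<close>.\<close>
  have "x = k * (a div k) \<or> x = k * (a div k) + a mod k + 1 \<or>
      (k < a mod k + 2 \<and> x = k * (a div k) + k)"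
    using assms by (auto simp: phi_letter_def Let_def split: if_splits)
  then show ?thesis using mult_div_mod_eq[of k a] by linarith
qed

lemma letters_W_le:
  assumes "x \<in> set (W k n)"
  shows "x \<le> n"
  using assms
proof (induction n arbitrary: x)
  case 0
  then show ?case by (simp add: W_def)
next
  case (Suc n)
  then obtain a where "a \<in> set (W k n)" "x \<in> set (phi_letter k a)"
    by (auto simp: W_Suc phi_def)
  with Suc.IH[of a] phi_letter_le[of x k a] show ?case by simp
qed

section \<open>Counting occurrences block by block\<close>

lemma finite_occurrences: "finite (occurrences B w)"
  by (rule finite_subset[of _ "{..length w}"]) (auto simp: occurrences_def)

lemma occurrences_shift: "occurrences (m \<oplus> B) (m \<oplus> w) = occurrences B w"
proof -
  have "inj (\<lambda>a. a + m)" by (simp add: inj_def)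
  then show ?thesis
    by (auto simp: occurrences_def shift_def drop_map take_map inj_map_eq_map)
qed

lemma within_block_Nil: "\<not> within_block [] p l"
  by (simp add: within_block_def)

text \<open>This replaces the existential over splittings by a recursion, so that counting can go by
  induction on the list of blocks.\<close>

lemma within_block_Cons:
  "within_block (b # bs) p l \<longleftrightarrow>
     p + l \<le> length b \<or> (length b \<le> p \<and> within_block bs (p - length b) l)" (is "?L \<longleftrightarrow> ?R")
proof
  assume ?L
  then obtain us c vs where *: "b # bs = us @ c # vs" "length (concat us) \<le> p"
    "p + l \<le> length (concat us) + length c" by (auto simp: within_block_def)
  show ?R
  proof (cases us)
    case Nil
    with * show ?thesis by simp
  next
    case (Cons d us')
    with * have "bs = us' @ c # vs" "length (concat us') \<le> p - length b"
      "p - length b + l \<le> length (concat us') + length c" "length b \<le> p" by auto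
    then show ?thesis unfolding within_block_def by blast
  qed
next
  assume ?R
  then show ?L
  proof
    assume "p + l \<le> length b"
    then show ?L unfolding within_block_def
      by (intro exI[of _ "[]"] exI[of _ b] exI[of _ bs]) simp
  next
    assume R: "length b \<le> p \<and> within_block bs (p - length b) l"
    then obtain us c vs where "bs = us @ c # vs" "length (concat us) \<le> p - length b"
      "p - length b + l \<le> length (concat us) + length c" by (auto simp: within_block_def)
    with R show ?L unfolding within_block_def
      by (intro exI[of _ "b # us"] exI[of _ c] exI[of _ vs]) auto
  qed
qed

lemma occurrences_append_left:
  assumes "p + length B \<le> length u"
  shows "p \<in> occurrences B (u @ v) \<longleftrightarrow> p \<in> occurrences B u"
  using assms by (simp add: occurrences_def)

lemma occurrences_append_right: "length u + p \<in> occurrences B (u @ v) \<longleftrightarrow> p \<in> occurrences B v"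
  by (simp add: occurrences_def)

text \<open>An included occurrence lies in the first block or is the translate of an included
  occurrence in the rest. As \<open>B\<close> is nonempty, an occurrence inside \<open>b\<close>
  starts before \<open>length b\<close>, so the two kinds are disjoint.\<close>

lemma card_occurrences_within_block:
  assumes "B \<noteq> []"
  shows "card {p \<in> occurrences B (concat bs). within_block bs p (length B)} =
    (\<Sum>b\<leftarrow>bs. count_factor b B)"
proof (induction bs)
  case Nil
  show ?case by (simp add: within_block_Nil)
next
  case (Cons b bs)
  let ?A = "{p \<in> occurrences B (concat bs). within_block bs p (length B)}"
  have "{p \<in> occurrences B (concat (b # bs)). within_block (b # bs) p (length B)} =
      occurrences B b \<union> (+) (length b) ` ?A" (is "?L = ?R")
  proof (rule set_eqI)
    fix p
    show "p \<in> ?L \<longleftrightarrow> p \<in> ?R"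
    proof (cases "length b \<le> p")
      case True
      then obtain q where p: "p = length b + q" by (auto simp: le_iff_add)
      have "p \<notin> occurrences B b" "\<not> p + length B \<le> length b"
        using assms p by (auto simp: occurrences_def)
      then show ?thesis
        by (auto simp: p within_block_Cons occurrences_append_right)
    next
      case False
      then have "p \<in> ?L \<longleftrightarrow> p + length B \<le> length b \<and> p \<in> occurrences B (b @ concat bs)"
        by (auto simp: within_block_Cons)
      also have "\<dots> \<longleftrightarrow> p \<in> occurrences B b"
        using occurrences_append_left[of p B b "concat bs"] by (auto simp: occurrences_def)
      finally show ?thesis using False by auto
    qed
  qed
  moreover have "occurrences B b \<inter> (+) (length b) ` ?A = {}"
    using assms by (auto simp: occurrences_def)
  moreover have "card ((+) (length b) ` ?A) = card ?A"
    by (intro card_image) simp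
  ultimately show ?case
    using Cons.IH by (simp add: card_Un_disjoint finite_occurrences count_factor_def)
qed

lemma count_factor_recurrence:
  assumes "k > 0" "B \<noteq> []" "k \<le> n" "all_occurrences_included k (k \<oplus> B)"
  shows "count_factor (W k n) (k \<oplus> B) =
    (\<Sum>i=1..k-1. count_factor (W k (n - i)) (k \<oplus> B)) + count_factor (W k (n - k)) B"
proof -
  let ?B = "k \<oplus> B"
  have "?B \<noteq> []" using assms(2) by (simp add: shift_def)
  have "occurrences ?B (W k n) =
      {p \<in> occurrences ?B (concat (blocks k n)). within_block (blocks k n) p (length ?B)}"
    using assms(3,4) W_eq_concat_blocks[OF assms(1,3)]
    unfolding all_occurrences_included_def by auto
  then have "count_factor (W k n) ?B = (\<Sum>b\<leftarrow>blocks k n. count_factor b ?B)"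
    using card_occurrences_within_block[OF \<open>?B \<noteq> []\<close>] by (simp add: count_factor_def)
  \<comment> \<open>In the last block the shift by \<open>k\<close> cancels on both sides, leaving
    occurrences of \<open>B\<close> in \<open>W k (n - k)\<close>.\<close>
  also have "\<dots> = (\<Sum>i\<leftarrow>[1..<k]. count_factor (W k (n - i)) ?B) + count_factor (W k (n - k)) B"
    by (simp add: blocks_def o_def count_factor_def occurrences_shift)
  also have "(\<Sum>i\<leftarrow>[1..<k]. count_factor (W k (n - i)) ?B) =
      (\<Sum>i=1..k-1. count_factor (W k (n - i)) ?B)"
    using assms(1) by (simp add: sum_list_distinct_conv_sum_set) (intro sum.cong; auto)
  finally show ?thesis .
qed

text \<open>Every letter of \<open>k \<oplus> B\<close> is at least \<open>k\<close>, whereas those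
  of \<open>W k n\<close> are at most \<open>n\<close>.\<close>

lemma count_factor_shift_eq_0:
  assumes "B \<noteq> []" "n < k"
  shows "count_factor (W k n) (k \<oplus> B) = 0"
proof -
  have "occurrences (k \<oplus> B) (W k n) = {}"
  proof (rule equals0I)
    fix p assume "p \<in> occurrences (k \<oplus> B) (W k n)"
    then have "set (k \<oplus> B) \<subseteq> set (W k n)"
      unfolding occurrences_def by
        (metis (mono_tags) mem_Collect_eq set_drop_subset set_take_subset subset_trans)
    moreover have "hd B + k \<in> set (k \<oplus> B)" using assms(1) by (simp add: shift_def)
    ultimately have "hd B + k \<le> n" using letters_W_le by blast
    with assms(2) show False by simp
  qed
  then show ?thesis by (simp add: count_factor_def)
qed

section \<open>Factors of the infinite word\<close>

lemma factor_inf_W_inf_iff: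
  assumes "k \<ge> 2"
  shows "factor_inf B (W_inf k) \<longleftrightarrow> (\<exists>n. sublist B (W k n))"
proof
  assume "factor_inf B (W_inf k)"
  then obtain p where p: "map (W_inf k) [p..<p + length B] = B" by (auto simp: factor_inf_def)
  \<comment> \<open>By \<open>length_W\<close> the word \<open>W k n\<close> has more than
    \<open>n\<close> letters, so it contains the whole window.\<close>
  define n where "n = p + length B"
  have n: "p + length B \<le> length (W k n)"
    using length_W[OF assms, of n] by (simp add: n_def)
  have "take (length B) (drop p (W k n)) = map (W_inf k) [p..<p + length B]"
    using n by (intro nth_equalityI) (auto simp: W_inf_nth[OF assms, of _ n])
  then have "B = take (length B) (drop p (W k n))" using p by simp
  then show "\<exists>n. sublist B (W k n)"
    by (metis sublist_take sublist_drop sublist_order.order_trans)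
next
  assume "\<exists>n. sublist B (W k n)"
  then obtain n us vs where w: "W k n = us @ B @ vs" by (auto simp: sublist_def)
  have "map (W_inf k) [length us..<length us + length B] = B"
    by (intro nth_equalityI) (auto simp: W_inf_nth[OF assms, of _ n] w nth_append)
  then show "factor_inf B (W_inf k)" by (auto simp: factor_inf_def)
qed

text \<open>The word \<open>k \<oplus> W k n\<close> is the last block of
  \<open>W k (n + k)\<close>.\<close>

lemma factor_inf_shift:
  assumes "k \<ge> 2" and "factor_inf B (W_inf k)"
  shows "factor_inf (k \<oplus> B) (W_inf k)"
proof -
  obtain n us vs where "W k n = us @ B @ vs"
    using assms by (auto simp: factor_inf_W_inf_iff sublist_def)
  then have "sublist (k \<oplus> B) (k \<oplus> W k n)" by (simp add: shift_append)
  moreover have "sublist (k \<oplus> W k n) (W k (n + k))"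
    using W_eq_concat_blocks[of k "n + k"] assms(1) by (simp add: blocks_def)
  ultimately show ?thesis
    unfolding factor_inf_W_inf_iff[OF assms(1)] by (blast intro: sublist_order.order_trans)
qed

section \<open>Generating functions\<close>

lemma fps_mult_sum_X_power_nth:
  fixes f :: "'a::comm_ring_1 fps"
  shows "fps_nth (f * (\<Sum>i\<in>I. fps_X ^ i)) n = (\<Sum>i\<in>I. if n < i then 0 else fps_nth f (n - i))"
  by (simp add: sum_distrib_left fps_sum_nth fps_X_power_mult_right_nth)

lemma eq_mult_H_fps:
  assumes "f * (1 - (\<Sum>i=1..m. fps_X ^ i)) = g"
  shows "f = g * H_fps m"
proof -
  let ?D = "1 - (\<Sum>i=1..m. fps_X ^ i) :: rat fps"
  \<comment> \<open>The sum starts at \<open>i = 1\<close>, so the constant term is 1 and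
    \<open>?D\<close> is invertible.\<close>
  have D: "fps_nth ?D 0 \<noteq> 0" by (simp add: fps_sum_nth)
  then have "H_fps m = inverse ?D" by (simp add: H_fps_def fps_divide_unit)
  then show ?thesis using inverse_mult_eq_1'[OF D] assms by (metis mult.assoc mult.right_neutral)
qed

theorem theorem3p1:
  fixes k :: nat and B :: "nat list"
  assumes "k \<ge> 3" and "B \<noteq> []" and "factor_inf B (W_inf k)"
  shows "factor_inf (k \<oplus> B) (W_inf k) \<and>
    (all_occurrences_included k (k \<oplus> B) \<longrightarrow>
       C_fps k (k \<oplus> B) = fps_X ^ k * H_fps (k - 1) * C_fps k B)"
proof (intro conjI impI)
  show "factor_inf (k \<oplus> B) (W_inf k)" using assms by (intro factor_inf_shift) auto
next
  assume incl: "all_occurrences_included k (k \<oplus> B)"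
  have k: "k > 0" using assms(1) by simp
  have "C_fps k (k \<oplus> B) * (1 - (\<Sum>i=1..k-1. fps_X ^ i)) = fps_X ^ k * C_fps k B"
  proof (rule fps_ext)
    fix n
    have l: "fps_nth (C_fps k (k \<oplus> B) * (1 - (\<Sum>i=1..k-1. fps_X ^ i))) n =
        of_nat (count_factor (W k n) (k \<oplus> B)) -
        (\<Sum>i=1..k-1. if n < i then 0 else of_nat (count_factor (W k (n - i)) (k \<oplus> B)))"
      by (simp add: right_diff_distrib fps_mult_sum_X_power_nth C_fps_def cong: if_cong)
    have r: "fps_nth (fps_X ^ k * C_fps k B) n =
        (if n < k then 0 else of_nat (count_factor (W k (n - k)) B))"
      by (simp add: fps_X_power_mult_nth C_fps_def)
    show "fps_nth (C_fps k (k \<oplus> B) * (1 - (\<Sum>i=1..k-1. fps_X ^ i))) n = fps_nth (fps_X ^ k * C_fps k B) n"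
    proof (cases "n < k")
      case True
      \<comment> \<open>All indices \<open>n - i\<close> stay below \<open>k\<close>, so every count
        on the left vanishes; \<open>i = 0\<close> covers the leading term.\<close>
      then have "count_factor (W k (n - i)) (k \<oplus> B) = 0" for i
        using assms(2) by (intro count_factor_shift_eq_0) auto
      from this this[of 0] True show ?thesis unfolding l r by (simp cong: if_cong)
    next
      case False
      \<comment> \<open>Here \<open>i \<le> k - 1 < n\<close>, so the guard against truncated
        subtraction never applies.\<close>
      then have "(\<Sum>i=1..k-1. if n < i then 0 else of_nat (count_factor (W k (n - i)) (k \<oplus> B))) =
          (of_nat (\<Sum>i=1..k-1. count_factor (W k (n - i)) (k \<oplus> B)) :: rat)"
        unfolding of_nat_sum by (intro sum.cong) auto
      with False count_factor_recurrence[OF k assms(2) _ incl, of n] show ?thesis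
        unfolding l r by simp
    qed
  qed
  from eq_mult_H_fps[OF this]
  show "C_fps k (k \<oplus> B) = fps_X ^ k * H_fps (k - 1) * C_fps k B"
    by (simp add: mult_ac)
qed

end
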